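(* Let $G=(V,E,w,\mu)$ be a weighted undirected graph and let $\theta\in[0,1]$. Then $$h_{\theta}(G) =\min_{\text{nonconstant } x\in\mathbb{R}^n}\frac{\theta e\|x\|_{\infty}+(1-\theta)\|x\|_{1,d}-I^+(x)}{N(x)},$$ where $h_\theta(G)$ is the $\theta$-balanced cut value $$h_{\theta}(G)=\min_{(V_1,V_2)\in \mathrm{TC}(V)} \frac{\theta\sum_{i\in (V_1\cup V_2)^c}d_i+2|E( V_1,V_2)|}{\sum_{X\in\{V_1,V_2\}}\min\{\mathrm{vol}(X),\mathrm{vol}(X^c)\}}.$$
   Context: $G=(V,E,w,\mu)$ is an undirected graph without loops, $V=\{1,\dots,n\}$, $n\ge 2$; $\mu_i>0$ is a weight on each vertex $i$; $w_{ij}=w_{ji}>0$ if $\{i,j\}\in E$ and $w_{ij}=0$ otherwise. $d_i=\sum_{j:\{i,j\}\in E}w_{ij}$, $e=\sum_{i\in V}d_i$. For $S\subset V$: $S^c=V\setminus S$ and $\mathrm{vol}(S)=\sum_{i\in S}\mu_i$. For $S,T\subset V$, $E(S,T)$ is the set of edges between $S$ and $T$ and $|E(S,T)|=\sum_{\{i,j\}\in E(S,T)}w_{ij}$ (total weight). $\mathrm{TC}(V)=\{(V_1,V_2): V_1,V_2\subseteq V,\ V_1\cap V_2=\emptyset,\ V_1\cup V_2\neq\emptyset,\ V_1^c\neq\emptyset,\ V_2^c\neq\emptyset\}$ (one of $V_1,V_2$ may be empty). For $x\in\mathbb{R}^n$: $\|x\|_\infty=\max_i|x_i|$, $\|x\|_{1,d}=\sum_{i\in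 V}d_i|x_i|$, $I^+(x)=\sum_{\{i,j\}\in E}w_{ij}|x_i+x_j|$, $N(x)=\min_{c\in\mathbb{R}}\sum_{i\in V}\mu_i|x_i-c|$. "Nonconstant" means that not all components of $x$ are equal (equivalently $N(x)>0$). *)

theory Defs
  imports "HOL-Analysis.Analysis"
begin

(* The vertex set V = {1,...,n} is the whole finite type 'n, with n = CARD('n),
   and an edge is a two-element set of vertices. *)

definition weighted_graph ::
    "'n::finite set set \<Rightarrow> ('n \<Rightarrow> 'n \<Rightarrow> real) \<Rightarrow> ('n \<Rightarrow> real) \<Rightarrow> bool" where
  "weighted_graph E w \<mu> \<longleftrightarrow>
     (\<forall>e\<in>E. \<exists>i j. i \<noteq> j \<and> e = {i, j}) \<and>
     (\<forall>i. \<mu> i > 0) \<and>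
     (\<forall>i j. w i j = w j i) \<and>
     (\<forall>i j. {i, j} \<in> E \<longrightarrow> w i j > 0) \<and>
     (\<forall>i j. {i, j} \<notin> E \<longrightarrow> w i j = 0)"

(* The value of f at the unordered pair e = {i,j}; well defined when f is symmetric
   (lemma edge_value_pair). *)
definition edge_value :: "('n \<Rightarrow> 'n \<Rightarrow> real) \<Rightarrow> 'n set \<Rightarrow> real" where
  "edge_value f e = (THE r. \<exists>i j. e = {i, j} \<and> r = f i j)"

(* Each unordered edge {i,j} in F contributes f i j exactly once. *)
definition edge_sum :: "'n set set \<Rightarrow> ('n \<Rightarrow> 'n \<Rightarrow> real) \<Rightarrow> real" where
  "edge_sum F f = (\<Sum>e\<in>F. edge_value f e)"

definition deg :: "'n::finite set set \<Rightarrow> ('n \<Rightarrow> 'n \<Rightarrow> real) \<Rightarrow> 'n \<Rightarrow> real" where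
  "deg E w i = (\<Sum>j | {i, j} \<in> E. w i j)"

definition total_deg :: "'n::finite set set \<Rightarrow> ('n \<Rightarrow> 'n \<Rightarrow> real) \<Rightarrow> real" where
  "total_deg E w = (\<Sum>i\<in>UNIV. deg E w i)"

definition vol :: "('n \<Rightarrow> real) \<Rightarrow> 'n set \<Rightarrow> real" where
  "vol \<mu> S = (\<Sum>i\<in>S. \<mu> i)"

definition edges_between :: "'n set set \<Rightarrow> 'n set \<Rightarrow> 'n set \<Rightarrow> 'n set set" where
  "edges_between E S T = {{i, j} | i j. {i, j} \<in> E \<and> i \<in> S \<and> j \<in> T}"

definition cut_weight ::
    "'n set set \<Rightarrow> ('n \<Rightarrow> 'n \<Rightarrow> real) \<Rightarrow> 'n set \<Rightarrow> 'n set \<Rightarrow> real" where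
  "cut_weight E w S T = edge_sum (edges_between E S T) w"

definition TC :: "('n set \<times> 'n set) set" where
  "TC = {(V1, V2). V1 \<inter> V2 = {} \<and> V1 \<union> V2 \<noteq> {} \<and> - V1 \<noteq> {} \<and> - V2 \<noteq> {}}"

(* The sum over X in {V1, V2} is written out as two summands; the indexing is by position. *)
definition cut_ratio ::
    "'n::finite set set \<Rightarrow> ('n \<Rightarrow> 'n \<Rightarrow> real) \<Rightarrow> ('n \<Rightarrow> real) \<Rightarrow> real
      \<Rightarrow> 'n set \<Rightarrow> 'n set \<Rightarrow> real" where
  "cut_ratio E w \<mu> \<theta> V1 V2 =
     (\<theta> * (\<Sum>i\<in>- (V1 \<union> V2). deg E w i) + 2 * cut_weight E w V1 V2) /
     (min (vol \<mu> V1) (vol \<mu> (- V1)) + min (vol \<mu> V2) (vol \<mu> (- V2)))"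

definition balanced_cut ::
    "'n::finite set set \<Rightarrow> ('n \<Rightarrow> 'n \<Rightarrow> real) \<Rightarrow> ('n \<Rightarrow> real) \<Rightarrow> real \<Rightarrow> real" where
  "balanced_cut E w \<mu> \<theta> = Min ((\<lambda>(V1, V2). cut_ratio E w \<mu> \<theta> V1 V2) ` TC)"

definition norm_1d :: "'n::finite set set \<Rightarrow> ('n \<Rightarrow> 'n \<Rightarrow> real) \<Rightarrow> real ^ 'n \<Rightarrow> real" where
  "norm_1d E w x = (\<Sum>i\<in>UNIV. deg E w i * \<bar>x $ i\<bar>)"

definition I_plus :: "'n::finite set set \<Rightarrow> ('n \<Rightarrow> 'n \<Rightarrow> real) \<Rightarrow> real ^ 'n \<Rightarrow> real" where
  "I_plus E w x = edge_sum E (\<lambda>i j. w i j * \<bar>x $ i + x $ j\<bar>)"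

(* The infimum is attained (lemma N_dev_attained), so it is a minimum. *)
definition N_dev :: "('n::finite \<Rightarrow> real) \<Rightarrow> real ^ 'n \<Rightarrow> real" where
  "N_dev \<mu> x = (INF c. \<Sum>i\<in>UNIV. \<mu> i * \<bar>x $ i - c\<bar>)"

definition nonconstant :: "real ^ 'n::finite \<Rightarrow> bool" where
  "nonconstant x \<longleftrightarrow> (\<exists>i j. x $ i \<noteq> x $ j)"

(* infnorm is max |x_i|, see infnorm_cart. *)
definition vector_ratio ::
    "'n::finite set set \<Rightarrow> ('n \<Rightarrow> 'n \<Rightarrow> real) \<Rightarrow> ('n \<Rightarrow> real) \<Rightarrow> real
      \<Rightarrow> real ^ 'n \<Rightarrow> real" where
  "vector_ratio E w \<mu> \<theta> x =
     (\<theta> * total_deg E w * infnorm x + (1 - \<theta>) * norm_1d E w x - I_plus E w x) / N_dev \<mu> x"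


lemma edge_value_pair:
  assumes "\<And>i j. f i j = f j i"
  shows "edge_value f {i, j} = f i j"
  unfolding edge_value_def
  by (rule the_equality) (use assms in \<open>auto simp: doubleton_eq_iff\<close>)

lemma TC_nonempty:
  assumes "CARD('n::finite) \<ge> 2"
  shows "(TC :: ('n set \<times> 'n set) set) \<noteq> {}"
proof -
  fix a :: 'n
  have "({a} :: 'n set) \<noteq> UNIV"
  proof
    assume "{a} = (UNIV :: 'n set)"
    then have "CARD('n) = card {a}" by simp
    with assms show False by simp
  qed
  then have "({a}, {}) \<in> (TC :: ('n set \<times> 'n set) set)"
    by (auto simp: TC_def)
  then show ?thesis by blast
qed

lemma N_dev_attained:
  fixes x :: "real ^ 'n::finite"
  assumes mu: "\<And>i. \<mu> i > 0"
  obtains c where "N_dev \<mu> x = (\<Sum>i\<in>UNIV. \<mu> i * \<bar>x $ i - c\<bar>)"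
    and "\<And>c'. N_dev \<mu> x \<le> (\<Sum>i\<in>UNIV. \<mu> i * \<bar>x $ i - c'\<bar>)"
proof -
  define f where "f c = (\<Sum>i\<in>UNIV. \<mu> i * \<bar>x $ i - c\<bar>)" for c
  define B where "B = infnorm x"
  have B: "\<bar>x $ i\<bar> \<le> B" for i
    unfolding B_def by (rule component_le_infnorm_cart)
  have "0 \<le> B" unfolding B_def by (rule infnorm_pos_le)
  then have "{-B..B} \<noteq> {}" by simp
  moreover have "continuous_on {-B..B} f"
    unfolding f_def by (intro continuous_intros)
  ultimately obtain c where c: "\<And>y. y \<in> {-B..B} \<Longrightarrow> f c \<le> f y"
    using continuous_attains_inf[OF compact_Icc, of "-B" B f] by blast
  have le: "f c \<le> f y" for y
  proof -
    define y' where "y' = max (-B) (min B y)"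
    have "f c \<le> f y'"
      using \<open>0 \<le> B\<close> by (intro c) (auto simp: y'_def)
    also have "f y' \<le> f y"
      unfolding f_def
    proof (intro sum_mono mult_left_mono)
      fix i :: 'n
      show "\<bar>x $ i - y'\<bar> \<le> \<bar>x $ i - y\<bar>"
        using B[of i] unfolding y'_def by linarith
      show "0 \<le> \<mu> i" using mu[of i] by simp
    qed
    finally show ?thesis .
  qed
  have "N_dev \<mu> x = f c"
    unfolding N_dev_def f_def[symmetric] using le by (intro cInf_eq_minimum) auto
  then show ?thesis
    using that le unfolding f_def by metis
qed

end

theory Submission
  imports Defs
begin

text \<open>
  Both sides are compared through the level sets of \<open>x\<close>: for \<open>t \<ge> 0\<close> let
  \<open>V\<^sub>t\<^sup>+ = {i. x\<^sub>i > t}\<close> and \<open>V\<^sub>t\<^sup>- = {i. - x\<^sub>i > t}\<close>. Numerator and denominator of the vector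
  ratio are (Lovasz-type) extensions of the corresponding set functions: with \<open>M = \<parallel>x\<parallel>\<^sub>\<infinity>\<close>, the
  numerator at \<open>x\<close> is the integral over \<open>t \<in> [0, M]\<close> of the numerator of the cut ratio at
  \<open>(V\<^sub>t\<^sup>+, V\<^sub>t\<^sup>-)\<close>, and \<open>N(x)\<close> is the integral of its denominator.

  For the numerator this is the layer-cake formula \<open>|a| = \<integral> [t < |a|] dt\<close> together with
  \<open>|a| + |b| - |a + b| = 2 min(|a|, |b|)\<close> for \<open>a\<close>, \<open>b\<close> of opposite sign and \<open>0\<close> otherwise: an edge
  contributes exactly for those \<open>t\<close> for which it joins \<open>V\<^sub>t\<^sup>+\<close> and \<open>V\<^sub>t\<^sup>-\<close> (lemmas
  \<open>numerator_double_sum\<close> and \<open>numerator_has_integral\<close>). For the denominator, \<open>N(x)\<close> is at most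
  \<open>\<Sum> \<mu>\<^sub>i |x\<^sub>i - c|\<close> with \<open>c\<close> a weighted median. The median decides which of \<open>V\<^sub>t\<^sup>\<plusminus>\<close> and its
  complement is the lighter one, so that layering \<open>|x\<^sub>i - c|\<close> produces the minima in the
  denominator of the cut ratio (lemmas \<open>weighted_median\<close>, \<open>median_level_set_le\<close> and
  \<open>deviation_has_integral\<close>). Integrating the inequality \<open>h * denominator \<le> numerator\<close>, valid for
  every pair of disjoint sets (lemma \<open>balanced_cut_le\<close>), gives \<open>h \<le>\<close> the vector ratio.

  Conversely, if \<open>(V\<^sub>1, V\<^sub>2)\<close> attains \<open>h\<close>, its signed indicator vector has the same numerator as the
  cut ratio, and its \<open>N\<close> is at least the denominator (lemma \<open>N_dev_signed_indicator\<close>); hence its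
  vector ratio is at most \<open>h\<close>.
\<close>

section \<open>Sums over edges as double sums over vertices\<close>

text \<open>Each edge is counted twice, once for each of its two orientations, which are distinct because
  there are no loops.\<close>
lemma edge_sum_double:
  fixes E :: "'n::finite set set" and f :: "'n \<Rightarrow> 'n \<Rightarrow> real"
  assumes E: "\<And>e. e \<in> E \<Longrightarrow> \<exists>i j. i \<noteq> j \<and> e = {i, j}" and sym: "\<And>i j. f i j = f j i"
  shows "2 * edge_sum E f = (\<Sum>i\<in>UNIV. \<Sum>j\<in>UNIV. if {i, j} \<in> E then f i j else 0)"
proof -
  define P where "P = {p :: 'n \<times> 'n. {fst p, snd p} \<in> E}"
  define pair where "pair = (\<lambda>p :: 'n \<times> 'n. {fst p, snd p})"
  have img: "pair ` P = E"
    using E by (force simp: P_def pair_def image_iff)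
  have "(\<Sum>i\<in>UNIV. \<Sum>j\<in>UNIV. if {i, j} \<in> E then f i j else 0)
      = (\<Sum>p\<in>UNIV. if p \<in> P then f (fst p) (snd p) else 0)"
    by (simp add: sum.cartesian_product P_def case_prod_unfold)
  also have "\<dots> = (\<Sum>p\<in>P. f (fst p) (snd p))"
    by (simp add: sum.If_cases)
  also have "\<dots> = (\<Sum>e\<in>E. \<Sum>p | p \<in> P \<and> pair p = e. f (fst p) (snd p))"
    using sum.image_gen[of P "\<lambda>p. f (fst p) (snd p)" pair] by (simp add: img)
  also have "\<dots> = (\<Sum>e\<in>E. 2 * edge_value f e)"
  proof (rule sum.cong[OF refl])
    fix e assume e: "e \<in> E"
    then obtain i j where ij: "i \<noteq> j" "e = {i, j}" using E by blast
    have "{p. p \<in> P \<and> pair p = e} = {(i, j), (j, i)}"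
      using e ij by (auto simp: P_def pair_def doubleton_eq_iff insert_commute)
    then show "(\<Sum>p | p \<in> P \<and> pair p = e. f (fst p) (snd p)) = 2 * edge_value f e"
      using ij sym[of i j] by (simp add: edge_value_pair[of f, OF sym])
  qed
  finally show ?thesis by (simp add: edge_sum_def sum_distrib_left)
qed

lemma weighted_graph_nonneg:
  assumes "weighted_graph E w \<mu>"
  shows "0 \<le> w i j"
  using assms unfolding weighted_graph_def by (cases "{i, j} \<in> E") (auto intro: less_imp_le)

lemma deg_eq_sum:
  assumes "weighted_graph E w \<mu>"
  shows "deg E w i = (\<Sum>j\<in>UNIV. w i j)"
proof -
  have "w i j = 0" if "{i, j} \<notin> E" for j
    using assms that unfolding weighted_graph_def by blast
  then show ?thesis unfolding deg_def by (intro sum.mono_neutral_left) auto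
qed

lemma deg_nonneg:
  assumes "weighted_graph E w \<mu>"
  shows "0 \<le> deg E w i"
  using weighted_graph_nonneg[OF assms] by (simp add: deg_eq_sum[OF assms] sum_nonneg)

lemma I_plus_double:
  assumes G: "weighted_graph E w \<mu>"
  shows "2 * I_plus E w x = (\<Sum>i\<in>UNIV. \<Sum>j\<in>UNIV. w i j * \<bar>x $ i + x $ j\<bar>)"
proof -
  have "2 * I_plus E w x
      = (\<Sum>i\<in>UNIV. \<Sum>j\<in>UNIV. if {i, j} \<in> E then w i j * \<bar>x $ i + x $ j\<bar> else 0)"
    unfolding I_plus_def
    by (rule edge_sum_double) (use G in \<open>auto simp: weighted_graph_def add.commute\<close>)
  also have "\<dots> = (\<Sum>i\<in>UNIV. \<Sum>j\<in>UNIV. w i j * \<bar>x $ i + x $ j\<bar>)"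
    using G by (intro sum.cong) (auto simp: weighted_graph_def)
  finally show ?thesis .
qed

lemma cut_weight_double:
  assumes G: "weighted_graph E w \<mu>"
  shows "2 * cut_weight E w V1 V2 =
    (\<Sum>i\<in>UNIV. \<Sum>j\<in>UNIV. w i j * of_bool (i \<in> V1 \<and> j \<in> V2 \<or> i \<in> V2 \<and> j \<in> V1))"
proof -
  have mem: "{i, j} \<in> edges_between E V1 V2 \<longleftrightarrow>
      {i, j} \<in> E \<and> (i \<in> V1 \<and> j \<in> V2 \<or> i \<in> V2 \<and> j \<in> V1)" for i j
  proof
    assume "{i, j} \<in> edges_between E V1 V2"
    then show "{i, j} \<in> E \<and> (i \<in> V1 \<and> j \<in> V2 \<or> i \<in> V2 \<and> j \<in> V1)"
      unfolding edges_between_def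
      by (smt (verit) mem_Collect_eq doubleton_eq_iff)
  next
    assume "{i, j} \<in> E \<and> (i \<in> V1 \<and> j \<in> V2 \<or> i \<in> V2 \<and> j \<in> V1)"
    then show "{i, j} \<in> edges_between E V1 V2"
      unfolding edges_between_def mem_Collect_eq by (metis insert_commute)
  qed
  have "2 * cut_weight E w V1 V2
      = (\<Sum>i\<in>UNIV. \<Sum>j\<in>UNIV. if {i, j} \<in> edges_between E V1 V2 then w i j else 0)"
    unfolding cut_weight_def
  proof (rule edge_sum_double)
    fix e assume "e \<in> edges_between E V1 V2"
    then have "e \<in> E" by (auto simp: edges_between_def)
    then show "\<exists>i j. i \<noteq> j \<and> e = {i, j}" using G by (auto simp: weighted_graph_def)
  qed (use G in \<open>auto simp: weighted_graph_def\<close>)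
  also have "\<dots> = (\<Sum>i\<in>UNIV. \<Sum>j\<in>UNIV.
      w i j * of_bool (i \<in> V1 \<and> j \<in> V2 \<or> i \<in> V2 \<and> j \<in> V1))"
    using G unfolding mem by (intro sum.cong) (auto simp: weighted_graph_def)
  finally show ?thesis .
qed

text \<open>The point of this form is that every summand depends on at most two coordinates of \<open>x\<close>. The
  \<open>\<theta>\<close>-free part uses \<open>\<parallel>x\<parallel>\<^bsub>1,d\<^esub> = \<Sum> w\<^sub>i\<^sub>j (|x\<^sub>i| + |x\<^sub>j|)\<close>, summed over the edges.\<close>
lemma numerator_double_sum:
  assumes G: "weighted_graph E w \<mu>"
  shows "\<theta> * total_deg E w * M + (1 - \<theta>) * norm_1d E w x - I_plus E w x =
    \<theta> * (\<Sum>i\<in>UNIV. deg E w i * (M - \<bar>x $ i\<bar>)) +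
    (\<Sum>i\<in>UNIV. \<Sum>j\<in>UNIV. w i j * ((\<bar>x $ i\<bar> + \<bar>x $ j\<bar> - \<bar>x $ i + x $ j\<bar>) / 2))"
proof -
  have n1: "norm_1d E w x = (\<Sum>i\<in>UNIV. \<Sum>j\<in>UNIV. w i j * \<bar>x $ i\<bar>)"
    by (simp add: norm_1d_def deg_eq_sum[OF G] sum_distrib_right)
  also have "\<dots> = (\<Sum>i\<in>UNIV. \<Sum>j\<in>UNIV. w i j * \<bar>x $ j\<bar>)"
    using G by (subst sum.swap) (simp add: weighted_graph_def)
  finally have n2: "norm_1d E w x = (\<Sum>i\<in>UNIV. \<Sum>j\<in>UNIV. w i j * \<bar>x $ j\<bar>)" .
  have "2 * (\<Sum>i\<in>UNIV. \<Sum>j\<in>UNIV. w i j * ((\<bar>x $ i\<bar> + \<bar>x $ j\<bar> - \<bar>x $ i + x $ j\<bar>) / 2))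
      = (\<Sum>i\<in>UNIV. \<Sum>j\<in>UNIV. w i j * \<bar>x $ i\<bar> + w i j * \<bar>x $ j\<bar> - w i j * \<bar>x $ i + x $ j\<bar>)"
    unfolding sum_distrib_left by (intro sum.cong refl) (simp add: field_simps)
  also have "\<dots> = 2 * norm_1d E w x - 2 * I_plus E w x"
    by (simp add: sum.distrib sum_subtractf I_plus_double[OF G] n1[symmetric] n2[symmetric])
  finally have "(\<Sum>i\<in>UNIV. \<Sum>j\<in>UNIV. w i j * ((\<bar>x $ i\<bar> + \<bar>x $ j\<bar> - \<bar>x $ i + x $ j\<bar>) / 2))
      = norm_1d E w x - I_plus E w x" by simp
  moreover have "(\<Sum>i\<in>UNIV. deg E w i * (M - \<bar>x $ i\<bar>)) = total_deg E w * M - norm_1d E w x"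
    by (simp add: total_deg_def norm_1d_def sum_distrib_right sum_subtractf right_diff_distrib)
  ultimately show ?thesis by (simp only:) (simp add: algebra_simps)
qed

section \<open>Layer-cake formulas\<close>

lemma has_integral_of_bool_less:
  fixes s M :: real
  assumes "s \<le> M" "0 \<le> M"
  shows "((\<lambda>t. of_bool (t < s)) has_integral max 0 s) {0..M}"
proof (cases "0 \<le> s")
  case True
  have "((\<lambda>_. 1 :: real) has_integral s) {0..s}"
    using has_integral_const_real[of "1::real" 0 s] True by simp
  then have "((\<lambda>t. of_bool (t < s)) has_integral s) {0..s}"
    by (rule has_integral_spike[rotated 2, where S = "{s}"]) auto
  moreover have "((\<lambda>t. of_bool (t < s) :: real) has_integral 0) {s..M}"
    by (rule has_integral_is_0) auto
  ultimately show ?thesis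
    using has_integral_combine[of 0 s M "\<lambda>t. of_bool (t < s) :: real" s 0] True assms by simp
next
  case False
  then show ?thesis by (auto intro!: has_integral_is_0)
qed

text \<open>The half defect in the triangle inequality is the length of the set of \<open>t\<close> for which \<open>a\<close> and
  \<open>b\<close> lie beyond \<open>t\<close> on opposite sides of the origin.\<close>
lemma has_integral_opposite:
  fixes a b M :: real
  assumes "\<bar>a\<bar> \<le> M" "\<bar>b\<bar> \<le> M"
  shows "((\<lambda>t. of_bool (t < a \<and> t < - b \<or> t < - a \<and> t < b)) has_integral
     (\<bar>a\<bar> + \<bar>b\<bar> - \<bar>a + b\<bar>) / 2) {0..M}"
proof -
  have "((\<lambda>t. of_bool (t < min a (- b)) + of_bool (t < min (- a) b)) has_integral
     max 0 (min a (- b)) + max 0 (min (- a) b)) {0..M}"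
    by (intro has_integral_add has_integral_of_bool_less) (use assms in auto)
  also have "max 0 (min a (- b)) + max 0 (min (- a) b) = (\<bar>a\<bar> + \<bar>b\<bar> - \<bar>a + b\<bar>) / 2"
    by (auto simp: max_def min_def abs_if)
  finally show ?thesis
    by (rule has_integral_eq[rotated]) auto
qed

lemma has_integral_outside:
  fixes a M :: real
  assumes "\<bar>a\<bar> \<le> M"
  shows "((\<lambda>t. of_bool (\<not> t < a \<and> \<not> t < - a)) has_integral M - \<bar>a\<bar>) {0..M}"
proof -
  have "((\<lambda>t. 1 - of_bool (t < \<bar>a\<bar>) :: real) has_integral M - max 0 \<bar>a\<bar>) {0..M}"
    using assms abs_ge_zero[of a] has_integral_const_real[of "1::real" 0 M]
    by (intro has_integral_diff has_integral_of_bool_less)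
      (auto simp del: abs_ge_zero)
  then have "((\<lambda>t. 1 - of_bool (t < \<bar>a\<bar>) :: real) has_integral M - \<bar>a\<bar>) {0..M}" by simp
  then show ?thesis by (rule has_integral_eq[rotated]) auto
qed

text \<open>Positive and negative parts are layered separately, since the two sets of a pair in \<open>TC\<close> are
  treated separately in the denominator of the cut ratio.\<close>
lemma has_integral_deviation:
  fixes a c M :: real
  assumes "\<bar>a\<bar> \<le> M" "\<bar>c\<bar> \<le> M"
  shows "((\<lambda>t. of_bool ((t < a) \<noteq> (t < c)) + of_bool ((t < - a) \<noteq> (t < - c))) has_integral
     \<bar>a - c\<bar>) {0..M}"
proof -
  have half: "((\<lambda>t. of_bool ((t < p) \<noteq> (t < q))) has_integral \<bar>max 0 p - max 0 q\<bar>) {0..M}"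
    if "\<bar>p\<bar> \<le> M" "\<bar>q\<bar> \<le> M" for p q
  proof -
    have "((\<lambda>t. of_bool (t < max p q) - of_bool (t < min p q) :: real) has_integral
       max 0 (max p q) - max 0 (min p q)) {0..M}"
      using that by (intro has_integral_diff has_integral_of_bool_less) auto
    also have "max 0 (max p q) - max 0 (min p q) = \<bar>max 0 p - max 0 q\<bar>"
      by (auto simp: max_def min_def)
    finally show ?thesis by (rule has_integral_eq[rotated]) auto
  qed
  have "\<bar>max 0 a - max 0 c\<bar> + \<bar>max 0 (- a) - max 0 (- c)\<bar> = \<bar>a - c\<bar>"
    by (auto simp: max_def)
  then show ?thesis
    using has_integral_add[OF half[of a c] half[of "- a" "- c"]] assms by simp
qed

section \<open>Numerator and denominator as integrals over level sets\<close>

lemma numerator_has_integral: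
  fixes x :: "real ^ 'n::finite"
  assumes G: "weighted_graph E w \<mu>"
  shows "((\<lambda>t. \<theta> * (\<Sum>i\<in>- ({i. t < x $ i} \<union> {i. t < - x $ i}). deg E w i)
        + 2 * cut_weight E w {i. t < x $ i} {i. t < - x $ i}) has_integral
     \<theta> * total_deg E w * infnorm x + (1 - \<theta>) * norm_1d E w x - I_plus E w x) {0..infnorm x}"
proof -
  have le: "\<bar>x $ i\<bar> \<le> infnorm x" for i by (rule component_le_infnorm_cart)
  have "((\<lambda>t. \<theta> * (\<Sum>i\<in>UNIV. deg E w i * of_bool (\<not> t < x $ i \<and> \<not> t < - x $ i))
      + (\<Sum>i\<in>UNIV. \<Sum>j\<in>UNIV. w i j *
          of_bool (t < x $ i \<and> t < - x $ j \<or> t < - x $ i \<and> t < x $ j))) has_integral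
     \<theta> * total_deg E w * infnorm x + (1 - \<theta>) * norm_1d E w x - I_plus E w x) {0..infnorm x}"
    unfolding numerator_double_sum[OF G]
    by (intro has_integral_add has_integral_sum finite has_integral_mult_right
        has_integral_opposite has_integral_outside le)
  moreover have "(\<Sum>i\<in>UNIV. deg E w i * of_bool (\<not> t < x $ i \<and> \<not> t < - x $ i))
      = (\<Sum>i\<in>- ({i. t < x $ i} \<union> {i. t < - x $ i}). deg E w i)" for t
    by (rule sum.mono_neutral_cong_right) auto
  ultimately show ?thesis
    by (simp add: cut_weight_double[OF G])
qed

lemma vol_nonneg:
  fixes S :: "'n::finite set"
  assumes "\<And>i. \<mu> i > 0"
  shows "0 \<le> vol \<mu> S"
  unfolding vol_def using assms by (intro sum_nonneg) (rule less_imp_le)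

text \<open>The median is the smallest coordinate whose lower level set carries at least half the mass.\<close>
lemma weighted_median:
  fixes x :: "'n::finite \<Rightarrow> real"
  assumes mu: "\<And>i. \<mu> i > 0"
  obtains k where "vol \<mu> {i. x i < x k} \<le> vol \<mu> {i. x i \<ge> x k}"
    and "vol \<mu> {i. x i > x k} \<le> vol \<mu> {i. x i \<le> x k}"
proof -
  define A where "A = {k. vol \<mu> {i. x i > x k} \<le> vol \<mu> {i. x i \<le> x k}}"
  have "Max (range x) \<in> range x" by (rule Max_in) auto
  then obtain m where m: "x m = Max (range x)" by force
  have "\<not> x i > x m" for i unfolding m not_less by (rule Max_ge) auto
  then have "vol \<mu> {i. x i > x m} = 0" by (simp add: vol_def)
  then have "m \<in> A" unfolding A_def using vol_nonneg[of \<mu>, OF mu] by simp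
  then have "Min (x ` A) \<in> x ` A" by (intro Min_in) auto
  then obtain k where k: "k \<in> A" "x k = Min (x ` A)" by force
  have "vol \<mu> {i. x i < x k} \<le> vol \<mu> {i. x i \<ge> x k}"
  proof (cases "{i. x i < x k} = {}")
    case True
    then have "vol \<mu> {i. x i < x k} = 0" by (simp add: vol_def)
    then show ?thesis using vol_nonneg[of \<mu>, OF mu] by simp
  next
    case False
    define B where "B = {i. x i < x k}"
    \<comment> \<open>Minimality of the median is applied to its predecessor among the coordinates.\<close>
    have "Max (x ` B) \<in> x ` B" using False by (intro Max_in) (auto simp: B_def)
    then obtain s where s: "s \<in> B" "x s = Max (x ` B)" by force
    have B_le: "x i \<le> x s" if "x i < x k" for i
      using that s(2) by (auto simp: B_def)
    have "s \<notin> A"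
    proof
      assume "s \<in> A"
      then have "x k \<le> x s" by (simp add: k(2))
      with s(1) show False by (simp add: B_def)
    qed
    moreover have "x i \<le> x s \<longleftrightarrow> x i < x k" for i
      using s(1) B_le[of i] by (auto simp: B_def)
    then have "{i. x i \<le> x s} = {i. x i < x k}" "{i. x i > x s} = {i. x i \<ge> x k}"
      by (auto simp flip: not_le)
    ultimately show ?thesis by (simp add: A_def)
  qed
  with k(1) that show ?thesis by (auto simp: A_def)
qed

text \<open>The sum is the mass of the points separated from the median \<open>c\<close> by the threshold \<open>t\<close>: it is the
  upper or the lower level set at \<open>t\<close>, according to the position of \<open>c\<close>, and this one is the lighter
  of the two.\<close>
lemma median_level_set_le:
  fixes x :: "'n::finite \<Rightarrow> real"
  assumes mu: "\<And>i. \<mu> i > 0"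
    and lower: "vol \<mu> {i. x i < c} \<le> vol \<mu> {i. x i \<ge> c}"
    and upper: "vol \<mu> {i. x i > c} \<le> vol \<mu> {i. x i \<le> c}"
  shows "(\<Sum>i\<in>UNIV. \<mu> i * of_bool ((t < x i) \<noteq> (t < c)))
    \<le> min (vol \<mu> {i. t < x i}) (vol \<mu> (- {i. t < x i}))"
proof -
  have mono: "vol \<mu> A \<le> vol \<mu> B" if "A \<subseteq> B" for A B :: "'n set"
    unfolding vol_def using that mu by (intro sum_mono2) (auto intro: less_imp_le)
  show ?thesis
  proof (cases "t < c")
    case True
    have "(\<Sum>i\<in>UNIV. \<mu> i * of_bool ((t < x i) \<noteq> (t < c))) = vol \<mu> (- {i. t < x i})"
      unfolding vol_def using True by (intro sum.mono_neutral_cong_right) auto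
    moreover have "vol \<mu> (- {i. t < x i}) \<le> vol \<mu> {i. x i < c}"
      using True by (intro mono) auto
    moreover have "vol \<mu> {i. x i \<ge> c} \<le> vol \<mu> {i. t < x i}"
      using True by (intro mono) auto
    ultimately show ?thesis using lower by simp
  next
    case False
    have "(\<Sum>i\<in>UNIV. \<mu> i * of_bool ((t < x i) \<noteq> (t < c))) = vol \<mu> {i. t < x i}"
      unfolding vol_def using False by (intro sum.mono_neutral_cong_right) auto
    moreover have "vol \<mu> {i. t < x i} \<le> vol \<mu> {i. x i > c}"
      using False by (intro mono) auto
    moreover have "vol \<mu> {i. x i \<le> c} \<le> vol \<mu> (- {i. t < x i})"
      using False by (intro mono) auto
    ultimately show ?thesis using upper by simp
  qed
qed

lemma deviation_has_integral:
  fixes x :: "real ^ 'n::finite"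
  assumes "\<bar>c\<bar> \<le> infnorm x"
  shows "((\<lambda>t. (\<Sum>i\<in>UNIV. \<mu> i * of_bool ((t < x $ i) \<noteq> (t < c)))
       + (\<Sum>i\<in>UNIV. \<mu> i * of_bool ((t < - x $ i) \<noteq> (t < - c)))) has_integral
     (\<Sum>i\<in>UNIV. \<mu> i * \<bar>x $ i - c\<bar>)) {0..infnorm x}"
proof -
  have "((\<lambda>t. \<Sum>i\<in>UNIV. \<mu> i * (of_bool ((t < x $ i) \<noteq> (t < c))
        + of_bool ((t < - x $ i) \<noteq> (t < - c)))) has_integral
     (\<Sum>i\<in>UNIV. \<mu> i * \<bar>x $ i - c\<bar>)) {0..infnorm x}"
    by (intro has_integral_sum finite has_integral_mult_right has_integral_deviation
        component_le_infnorm_cart assms)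
  then show ?thesis by (simp only: distrib_left sum.distrib)
qed

section \<open>The lower bound\<close>

lemma cut_numerator_nonneg:
  assumes "weighted_graph E w \<mu>" "0 \<le> \<theta>"
  shows "0 \<le> \<theta> * (\<Sum>i\<in>- (V1 \<union> V2). deg E w i) + 2 * cut_weight E w V1 V2"
  using assms deg_nonneg[OF assms(1)] weighted_graph_nonneg[OF assms(1)]
  by (auto simp: cut_weight_double intro!: add_nonneg_nonneg mult_nonneg_nonneg sum_nonneg)

lemma vol_pos:
  fixes S :: "'n::finite set"
  assumes "\<And>i. \<mu> i > 0" "S \<noteq> {}"
  shows "0 < vol \<mu> S"
  unfolding vol_def using assms by (intro sum_pos) auto

lemma cut_denominator_pos:
  fixes V1 V2 :: "'n::finite set"
  assumes mu: "\<And>i. \<mu> i > 0" and TC: "(V1, V2) \<in> TC"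
  shows "0 < min (vol \<mu> V1) (vol \<mu> (- V1)) + min (vol \<mu> V2) (vol \<mu> (- V2))"
proof -
  have "0 < min (vol \<mu> V1) (vol \<mu> (- V1)) \<or> 0 < min (vol \<mu> V2) (vol \<mu> (- V2))"
    using TC vol_pos[of \<mu>, OF mu] by (auto simp: TC_def)
  moreover have "0 \<le> min (vol \<mu> V1) (vol \<mu> (- V1))" "0 \<le> min (vol \<mu> V2) (vol \<mu> (- V2))"
    using vol_nonneg[of \<mu>, OF mu] by auto
  ultimately show ?thesis by linarith
qed

lemma balanced_cut_attained:
  fixes E :: "'n::finite set set"
  assumes "CARD('n) \<ge> 2"
  obtains V1 V2 where "(V1, V2) \<in> TC"
    and "balanced_cut E w \<mu> \<theta> = cut_ratio E w \<mu> \<theta> V1 V2"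
proof -
  have "balanced_cut E w \<mu> \<theta> \<in> (\<lambda>(V1, V2). cut_ratio E w \<mu> \<theta> V1 V2) ` TC"
    unfolding balanced_cut_def using TC_nonempty[OF assms] by (intro Min_in) auto
  with that show ?thesis by auto
qed

lemma balanced_cut_nonneg:
  fixes E :: "'n::finite set set"
  assumes "CARD('n) \<ge> 2" "weighted_graph E w \<mu>" "0 \<le> \<theta>"
  shows "0 \<le> balanced_cut E w \<mu> \<theta>"
proof -
  have mu: "\<mu> i > 0" for i using assms(2) by (simp add: weighted_graph_def)
  obtain V1 V2 :: "'n set" where V: "(V1, V2) \<in> TC"
    "balanced_cut E w \<mu> \<theta> = cut_ratio E w \<mu> \<theta> V1 V2"
    using balanced_cut_attained[OF assms(1)] by blast
  show ?thesis
    unfolding V(2) cut_ratio_def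
    using cut_numerator_nonneg[OF assms(2,3)] cut_denominator_pos[of \<mu>, OF mu V(1)]
    by (intro divide_nonneg_pos)
qed

text \<open>Level-set pairs need not lie in \<open>TC\<close>: both sets may be empty (at \<open>t = \<parallel>x\<parallel>\<^sub>\<infinity>\<close>), or one of them
  may be everything (when \<open>x\<close> has no sign change). In these cases the denominator vanishes, and the
  cross-multiplied inequality still holds.\<close>
lemma balanced_cut_le:
  fixes V1 V2 :: "'n::finite set"
  assumes G: "weighted_graph E w \<mu>" and "0 \<le> \<theta>" and disj: "V1 \<inter> V2 = {}"
  shows "balanced_cut E w \<mu> \<theta> * (min (vol \<mu> V1) (vol \<mu> (- V1)) + min (vol \<mu> V2) (vol \<mu> (- V2)))
    \<le> \<theta> * (\<Sum>i\<in>- (V1 \<union> V2). deg E w i) + 2 * cut_weight E w V1 V2"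
proof (cases "(V1, V2) \<in> TC")
  case True
  have mu: "\<mu> i > 0" for i using G by (simp add: weighted_graph_def)
  have "balanced_cut E w \<mu> \<theta> \<le> cut_ratio E w \<mu> \<theta> V1 V2"
    unfolding balanced_cut_def using True by (intro Min_le) force+
  then show ?thesis
    unfolding cut_ratio_def by (simp add: pos_le_divide_eq cut_denominator_pos[of \<mu>, OF mu True])
next
  case False
  have nonneg: "0 \<le> vol \<mu> S" for S :: "'n set"
    using G by (intro vol_nonneg) (simp add: weighted_graph_def)
  have empty: "vol \<mu> {} = 0" by (simp add: vol_def)
  have "min (vol \<mu> V1) (vol \<mu> (- V1)) + min (vol \<mu> V2) (vol \<mu> (- V2)) = 0"
  proof -
    consider "V1 = {}" "V2 = {}" | "V1 = UNIV" "V2 = {}" | "V1 = {}" "V2 = UNIV"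
      using False disj by (auto simp: TC_def)
    then show ?thesis
      by cases (use nonneg empty in simp_all)
  qed
  then show ?thesis using cut_numerator_nonneg[OF assms(1,2)] by simp
qed

lemma balanced_cut_times_N_dev_le:
  fixes x :: "real ^ 'n::finite"
  assumes card: "CARD('n) \<ge> 2" and G: "weighted_graph E w \<mu>" and "0 \<le> \<theta>"
  shows "balanced_cut E w \<mu> \<theta> * N_dev \<mu> x
    \<le> \<theta> * total_deg E w * infnorm x + (1 - \<theta>) * norm_1d E w x - I_plus E w x"
proof -
  have mu: "\<mu> i > 0" for i using G by (simp add: weighted_graph_def)
  define h where "h = balanced_cut E w \<mu> \<theta>"
  have h0: "0 \<le> h" unfolding h_def by (rule balanced_cut_nonneg[OF assms])
  obtain k where k: "vol \<mu> {i. x $ i < x $ k} \<le> vol \<mu> {i. x $ i \<ge> x $ k}"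
      "vol \<mu> {i. x $ i > x $ k} \<le> vol \<mu> {i. x $ i \<le> x $ k}"
    using weighted_median[of \<mu> "\<lambda>i. x $ i", OF mu] .
  define c where "c = x $ k"
  have "N_dev \<mu> x \<le> (\<Sum>i\<in>UNIV. \<mu> i * \<bar>x $ i - c\<bar>)"
    using N_dev_attained[of \<mu> x, OF mu] by metis
  then have "h * N_dev \<mu> x \<le> h * (\<Sum>i\<in>UNIV. \<mu> i * \<bar>x $ i - c\<bar>)"
    using h0 by (rule mult_left_mono)
  also have "\<dots> \<le> \<theta> * total_deg E w * infnorm x + (1 - \<theta>) * norm_1d E w x - I_plus E w x"
  proof (rule has_integral_le[OF has_integral_mult_right[OF deviation_has_integral]
        numerator_has_integral[OF G]])
    show "\<bar>c\<bar> \<le> infnorm x" unfolding c_def by (rule component_le_infnorm_cart)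
    fix t assume t: "t \<in> {0..infnorm x}"
    let ?P = "{i. t < x $ i}" and ?Q = "{i. t < - x $ i}"
    have "(\<Sum>i\<in>UNIV. \<mu> i * of_bool ((t < x $ i) \<noteq> (t < c))) \<le> min (vol \<mu> ?P) (vol \<mu> (- ?P))"
      using k unfolding c_def[symmetric] by (intro median_level_set_le mu)
    moreover have "(\<Sum>i\<in>UNIV. \<mu> i * of_bool ((t < - x $ i) \<noteq> (t < - c)))
        \<le> min (vol \<mu> ?Q) (vol \<mu> (- ?Q))"
      using k unfolding c_def[symmetric] by (intro median_level_set_le mu) auto
    ultimately have "h * ((\<Sum>i\<in>UNIV. \<mu> i * of_bool ((t < x $ i) \<noteq> (t < c)))
        + (\<Sum>i\<in>UNIV. \<mu> i * of_bool ((t < - x $ i) \<noteq> (t < - c))))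
      \<le> h * (min (vol \<mu> ?P) (vol \<mu> (- ?P)) + min (vol \<mu> ?Q) (vol \<mu> (- ?Q)))"
      using h0 by (intro mult_left_mono add_mono)
    also have "\<dots> \<le> \<theta> * (\<Sum>i\<in>- (?P \<union> ?Q). deg E w i) + 2 * cut_weight E w ?P ?Q"
      unfolding h_def using t by (intro balanced_cut_le[OF G \<open>0 \<le> \<theta>\<close>]) auto
    finally show "h * ((\<Sum>i\<in>UNIV. \<mu> i * of_bool ((t < x $ i) \<noteq> (t < c)))
        + (\<Sum>i\<in>UNIV. \<mu> i * of_bool ((t < - x $ i) \<noteq> (t < - c))))
      \<le> \<theta> * (\<Sum>i\<in>- (?P \<union> ?Q). deg E w i) + 2 * cut_weight E w ?P ?Q" .
  qed
  finally show ?thesis unfolding h_def .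
qed

section \<open>Signed indicator vectors\<close>

definition signed_indicator :: "'n::finite set \<Rightarrow> 'n set \<Rightarrow> real ^ 'n" where
  "signed_indicator V1 V2 = (\<chi> i. of_bool (i \<in> V1) - of_bool (i \<in> V2))"

lemma signed_indicator_nonconstant:
  assumes "(V1, V2) \<in> TC"
  shows "nonconstant (signed_indicator V1 V2)"
proof -
  obtain p q r where pqr: "p \<in> V1 \<union> V2" "q \<notin> V1" "r \<notin> V2" and disj: "V1 \<inter> V2 = {}"
    using assms by (auto simp: TC_def)
  let ?x = "signed_indicator V1 V2"
  have "?x $ p \<noteq> ?x $ q \<or> ?x $ p \<noteq> ?x $ r"
    using pqr disj by (auto simp: signed_indicator_def)
  then show ?thesis unfolding nonconstant_def by blast
qed

lemma infnorm_signed_indicator: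
  assumes "(V1, V2) \<in> TC"
  shows "infnorm (signed_indicator V1 V2) = 1"
proof (rule antisym)
  obtain p where p: "p \<in> V1 \<union> V2" and disj: "V1 \<inter> V2 = {}"
    using assms by (auto simp: TC_def)
  let ?x = "signed_indicator V1 V2"
  have "\<bar>?x $ i\<bar> \<le> 1" for i
    by (auto simp: signed_indicator_def)
  then show "infnorm ?x \<le> 1"
    unfolding infnorm_cart by (intro cSup_least) auto
  have "1 = \<bar>?x $ p\<bar>"
    using p disj by (auto simp: signed_indicator_def)
  also have "\<dots> \<le> infnorm ?x" by (rule component_le_infnorm_cart)
  finally show "1 \<le> infnorm ?x" .
qed

lemma numerator_signed_indicator:
  assumes G: "weighted_graph E w \<mu>" and TC: "(V1, V2) \<in> TC"
  defines "x \<equiv> signed_indicator V1 V2"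
  shows "\<theta> * total_deg E w * infnorm x + (1 - \<theta>) * norm_1d E w x - I_plus E w x
    = \<theta> * (\<Sum>i\<in>- (V1 \<union> V2). deg E w i) + 2 * cut_weight E w V1 V2"
proof -
  have disj: "V1 \<inter> V2 = {}" using TC by (auto simp: TC_def)
  have "(\<Sum>i\<in>UNIV. deg E w i * (infnorm x - \<bar>x $ i\<bar>)) = (\<Sum>i\<in>- (V1 \<union> V2). deg E w i)"
    using disj unfolding x_def infnorm_signed_indicator[OF TC]
    by (intro sum.mono_neutral_cong_right) (auto simp: signed_indicator_def)
  moreover have "(\<bar>x $ i\<bar> + \<bar>x $ j\<bar> - \<bar>x $ i + x $ j\<bar>) / 2
      = of_bool (i \<in> V1 \<and> j \<in> V2 \<or> i \<in> V2 \<and> j \<in> V1)" for i j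
    using disj by (auto simp: x_def signed_indicator_def)
  ultimately show ?thesis
    unfolding numerator_double_sum[OF G] cut_weight_double[OF G] by simp
qed

text \<open>If \<open>c \<ge> 0\<close>, a point of \<open>V\<^sub>1\<close> has deviation at least \<open>1 - c\<close>, and the others at least \<open>c\<close>, with
  an extra \<open>1\<close> on \<open>V\<^sub>2\<close>. With \<open>c\<close> cut off at \<open>1\<close>, the total deviation dominates a convex combination of
  \<open>vol V\<^sub>1\<close> and \<open>vol (- V\<^sub>1)\<close>, plus \<open>vol V\<^sub>2\<close>. The case \<open>c \<le> 0\<close> follows by exchanging \<open>V\<^sub>1\<close> and \<open>V\<^sub>2\<close>.\<close>
lemma deviation_signed_indicator_ge:
  fixes V1 V2 :: "'n::finite set"
  assumes mu: "\<And>i. \<mu> i > 0" and disj: "V1 \<inter> V2 = {}" and c: "0 \<le> c"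
  shows "min (vol \<mu> V1) (vol \<mu> (- V1)) + min (vol \<mu> V2) (vol \<mu> (- V2))
    \<le> (\<Sum>i\<in>UNIV. \<mu> i * \<bar>signed_indicator V1 V2 $ i - c\<bar>)"
proof -
  have vol_sum: "vol \<mu> S = (\<Sum>i\<in>UNIV. \<mu> i * of_bool (i \<in> S))" for S :: "'n set"
    unfolding vol_def by (rule sum.mono_neutral_cong_left) auto
  define b where "b = min c 1"
  have b: "0 \<le> b" "b \<le> 1" using c by (auto simp: b_def)
  define m where "m = min (vol \<mu> V1) (vol \<mu> (- V1))"
  have "m = (1 - b) * m + b * m" by (simp add: algebra_simps)
  also have "\<dots> \<le> (1 - b) * vol \<mu> V1 + b * vol \<mu> (- V1)"
    using b by (intro add_mono mult_left_mono) (auto simp: m_def)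
  finally have "m + min (vol \<mu> V2) (vol \<mu> (- V2))
      \<le> (1 - b) * vol \<mu> V1 + b * vol \<mu> (- V1) + vol \<mu> V2" by linarith
  also have "\<dots> = (\<Sum>i\<in>UNIV. \<mu> i *
      ((1 - b) * of_bool (i \<in> V1) + b * of_bool (i \<in> - V1) + of_bool (i \<in> V2)))"
    unfolding vol_sum by (simp only: sum_distrib_left sum.distrib distrib_left mult.left_commute)
  also have "\<dots> \<le> (\<Sum>i\<in>UNIV. \<mu> i * \<bar>signed_indicator V1 V2 $ i - c\<bar>)"
    using mu disj c
    by (intro sum_mono mult_left_mono)
      (auto simp: signed_indicator_def b_def min_def intro: less_imp_le)
  finally show ?thesis unfolding m_def .
qed

lemma N_dev_signed_indicator:
  fixes V1 V2 :: "'n::finite set"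
  assumes mu: "\<And>i. \<mu> i > 0" and disj: "V1 \<inter> V2 = {}"
  shows "min (vol \<mu> V1) (vol \<mu> (- V1)) + min (vol \<mu> V2) (vol \<mu> (- V2))
    \<le> N_dev \<mu> (signed_indicator V1 V2)"
proof -
  obtain c where c: "N_dev \<mu> (signed_indicator V1 V2)
      = (\<Sum>i\<in>UNIV. \<mu> i * \<bar>signed_indicator V1 V2 $ i - c\<bar>)"
    using N_dev_attained[of \<mu>, OF mu] by blast
  show ?thesis
  proof (cases "0 \<le> c")
    case True
    then show ?thesis unfolding c by (intro deviation_signed_indicator_ge mu disj)
  next
    case False
    have "min (vol \<mu> V2) (vol \<mu> (- V2)) + min (vol \<mu> V1) (vol \<mu> (- V1))
        \<le> (\<Sum>i\<in>UNIV. \<mu> i * \<bar>signed_indicator V2 V1 $ i - (- c)\<bar>)"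
      using False disj by (intro deviation_signed_indicator_ge mu) auto
    also have "\<dots> = (\<Sum>i\<in>UNIV. \<mu> i * \<bar>signed_indicator V1 V2 $ i - c\<bar>)"
      by (intro sum.cong refl arg_cong2[where f = "(*)"]) (simp add: signed_indicator_def)
    finally show ?thesis unfolding c by linarith
  qed
qed

section \<open>The variational formula\<close>

lemma N_dev_pos:
  fixes x :: "real ^ 'n::finite"
  assumes mu: "\<And>i. \<mu> i > 0" and "nonconstant x"
  shows "0 < N_dev \<mu> x"
proof -
  obtain c where c: "N_dev \<mu> x = (\<Sum>i\<in>UNIV. \<mu> i * \<bar>x $ i - c\<bar>)"
    using N_dev_attained[of \<mu>, OF mu] by blast
  obtain k where "x $ k \<noteq> c" using assms(2) unfolding nonconstant_def by metis
  then show ?thesis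
    unfolding c using mu
    by (intro sum_pos2[of _ k]) (auto simp: less_imp_le)
qed

theorem mainTheorem1:
  fixes E :: "'n::finite set set" and w :: "'n \<Rightarrow> 'n \<Rightarrow> real"
    and \<mu> :: "'n \<Rightarrow> real" and \<theta> :: real
  assumes "CARD('n) \<ge> 2" and "weighted_graph E w \<mu>" and "0 \<le> \<theta>" and "\<theta> \<le> 1"
  shows "(\<exists>x. nonconstant x \<and> balanced_cut E w \<mu> \<theta> = vector_ratio E w \<mu> \<theta> x) \<and>
         (\<forall>x. nonconstant x \<longrightarrow> balanced_cut E w \<mu> \<theta> \<le> vector_ratio E w \<mu> \<theta> x)"
proof -
  have mu: "\<mu> i > 0" for i using assms(2) by (simp add: weighted_graph_def)
  have lower: "balanced_cut E w \<mu> \<theta> \<le> vector_ratio E w \<mu> \<theta> x" if "nonconstant x" for x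
    unfolding vector_ratio_def
    using balanced_cut_times_N_dev_le[OF assms(1-3), of x] N_dev_pos[of \<mu>, OF mu that]
    by (simp add: pos_le_divide_eq)
  obtain V1 V2 :: "'n set" where TC: "(V1, V2) \<in> TC"
    and V: "balanced_cut E w \<mu> \<theta> = cut_ratio E w \<mu> \<theta> V1 V2"
    using balanced_cut_attained[OF assms(1)] by blast
  let ?x = "signed_indicator V1 V2"
  have nc: "nonconstant ?x" by (rule signed_indicator_nonconstant[OF TC])
  have "vector_ratio E w \<mu> \<theta> ?x \<le> cut_ratio E w \<mu> \<theta> V1 V2"
    unfolding vector_ratio_def cut_ratio_def numerator_signed_indicator[OF assms(2) TC]
    using TC
    by (intro divide_left_mono N_dev_signed_indicator cut_numerator_nonneg[OF assms(2,3)]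
        mult_pos_pos N_dev_pos[OF _ nc] cut_denominator_pos mu) (auto simp: TC_def)
  then have "balanced_cut E w \<mu> \<theta> = vector_ratio E w \<mu> \<theta> ?x"
    using lower[OF nc] V by simp
  with nc lower show ?thesis by blast
qed

end
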